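(* If $E$ is a $\kappa$-Fréchet–Urysohn topological vector space and $F$ is a metrizable topological vector space, then the product $E\times F$ is a $\kappa$-Fréchet–Urysohn space.
   Context: Topological vector spaces are over the field of real or complex numbers (the same field for $E$ and $F$) and are assumed Hausdorff (hence Tychonoff). $E\times F$ carries the product topology. $\omega=\{0,1,2,\dots\}$. A Tychonoff space $X$ is called $\kappa$-Fréchet–Urysohn if, for any open set $U\subseteq X$ and each point $x\in\overline{U}$, there exists a sequence $\{x_n\}_{n\in\omega}\subseteq U$ that converges to $x$. *)

theory Defs
  imports "HOL-Analysis.Analysis"
begin

text \<open>The class \<open>real_normed_field\<close> contains \<^typ>\<open>real\<close> and \<^typ>\<open>complex\<close>; by the theorem of
  Gelfand and Mazur, these are up to isometric isomorphism its only instances. So a scalar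
  type of this class means ``the field of real or complex numbers''.\<close>

locale topological_vector_space = vector_space scale
  for scale :: "'k::real_normed_field \<Rightarrow> 'a::ab_group_add \<Rightarrow> 'a" +
  fixes T :: "'a topology"
  assumes topspace_eq_UNIV: "topspace T = UNIV"
    and Hausdorff: "Hausdorff_space T"
    and continuous_add: "continuous_map (prod_topology T T) T (\<lambda>(x, y). x + y)"
    and continuous_scale: "continuous_map (prod_topology euclidean T) T (\<lambda>(c, x). scale c x)"

definition tychonoff_space :: "'a topology \<Rightarrow> bool" where
  "tychonoff_space X \<longleftrightarrow> completely_regular_space X \<and> Hausdorff_space X"

definition kappa_frechet_urysohn_space :: "'a topology \<Rightarrow> bool" where
  "kappa_frechet_urysohn_space X \<longleftrightarrow>
     tychonoff_space X \<and>
     (\<forall>U x. openin X U \<and> x \<in> X closure_of U \<longrightarrow>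
        (\<exists>s::nat \<Rightarrow> 'a. range s \<subseteq> U \<and> limitin X s x sequentially))"

end

theory Submission
  imports Defs
begin

text \<open>Let \<open>(x, y)\<close> be in the closure of the open set \<open>U\<close> and let \<open>U\<^sub>n\<close> be the projection to \<open>E\<close> of
  the part of \<open>U\<close> over the ball of radius \<open>1/(n+1)\<close> about \<open>y\<close>, so that \<open>x\<close> is in the closure of
  every \<open>U\<^sub>n\<close>. Unless \<open>E = 0\<close>, choose nonzero \<open>a\<^sub>n \<longlonglongrightarrow> 0\<close> in \<open>E\<close> and open sets \<open>O\<^sub>n\<close> containing \<open>x + a\<^sub>n\<close> whose
  closures avoid \<open>x\<close>. Then \<open>x\<close> is in the closure of the union of the sets \<open>(U\<^sub>n + a\<^sub>n) \<inter> O\<^sub>n\<close>, hence is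
  the limit of a sequence \<open>s\<close> in this union. If \<open>s\<^sub>k\<close> lies in the \<open>n\<^sub>k\<close>-th set, then
  \<open>n\<^sub>k\<close> tends to infinity, because no single \<open>O\<^sub>n\<close> can contain infinitely many \<open>s\<^sub>k\<close>; so
  \<open>s\<^sub>k - a\<^bsub>n\<^sub>k\<^esub>\<close> is in \<open>U\<^bsub>n\<^sub>k\<^esub>\<close> and tends to \<open>x\<close>.\<close>

context topological_vector_space
begin

lemma limitin_add:
  assumes "limitin T f a F" "limitin T g b F"
  shows "limitin T (\<lambda>i. f i + g i) (a + b) F"
proof -
  have "limitin (prod_topology T T) (\<lambda>i. (f i, g i)) (a, b) F"
    using assms by (simp add: limitin_pairwise o_def)
  from continuous_map_limit[OF continuous_add this] show ?thesis
    by (simp add: o_def)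
qed

lemma limitin_scale:
  assumes "(c \<longlongrightarrow> k) F" "limitin T f a F"
  shows "limitin T (\<lambda>i. scale (c i) (f i)) (scale k a) F"
proof -
  have "limitin (prod_topology euclidean T) (\<lambda>i. (c i, f i)) (k, a) F"
    using assms by (simp add: limitin_pairwise o_def)
  from continuous_map_limit[OF continuous_scale this] show ?thesis
    by (simp add: o_def)
qed

lemma limitin_diff:
  assumes "limitin T f a F" "limitin T g b F"
  shows "limitin T (\<lambda>i. f i - g i) (a - b) F"
  using limitin_add[OF assms(1) limitin_scale[OF tendsto_const[of "-1"] assms(2)]] by simp

lemma continuous_map_translation: "continuous_map T T (\<lambda>z. z + a)"
proof -
  have "continuous_map T (prod_topology T T) (\<lambda>z. (z, a))"
    by (simp add: continuous_map_pairwise o_def topspace_eq_UNIV)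
  from continuous_map_compose[OF this continuous_add] show ?thesis
    by (simp add: o_def)
qed

lemma openin_translation_vimage:
  assumes "openin T G"
  shows "openin T {z. z + a \<in> G}"
  using openin_continuous_map_preimage[OF continuous_map_translation assms]
  by (simp add: topspace_eq_UNIV)

text \<open>The multiples of \<open>v\<close> by 1/(n+1) serve: the scalars tend to 0 and scaling is
  continuous.\<close>

lemma nonzero_null_sequence:
  fixes v :: 'a
  assumes "v \<noteq> 0"
  obtains a :: "nat \<Rightarrow> 'a" where "\<And>n. a n \<noteq> 0" "limitin T a 0 sequentially"
proof
  let ?a = "\<lambda>n. scale (of_real (inverse (real (Suc n)))) v"
  show "?a n \<noteq> 0" for n
    using assms by (simp add: scale_eq_0_iff del: of_nat_Suc)
  have "(\<lambda>n. of_real (inverse (real (Suc n))) :: 'k) \<longlonglongrightarrow> of_real 0"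
    by (intro tendsto_of_real LIMSEQ_inverse_real_of_nat)
  then have "limitin T ?a (scale (of_real 0) v) sequentially"
    by (rule limitin_scale) (simp add: topspace_eq_UNIV)
  then show "limitin T ?a 0 sequentially"
    by simp
qed

text \<open>The shift by \<open>a n\<close> encodes the index n in the position of a point, so one
  convergent sequence in a single open set handles all \<open>U n\<close> at once. The sets
  \<open>U n\<close> need not be decreasing.\<close>

lemma kappa_frechet_urysohn_diagonal_sequence:
  fixes v :: 'a
  assumes kFU: "kappa_frechet_urysohn_space T" and "v \<noteq> 0"
    and U: "\<And>n::nat. openin T (U n)" "\<And>n. x \<in> T closure_of U n"
  obtains m :: "nat \<Rightarrow> nat" and t
  where "filterlim m at_top sequentially" "\<And>k. t k \<in> U (m k)" "limitin T t x sequentially"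
proof -
  obtain a where a: "\<And>n::nat. a n \<noteq> 0" "limitin T a 0 sequentially"
    using nonzero_null_sequence[OF \<open>v \<noteq> 0\<close>] by blast
  have "\<exists>Q P. openin T Q \<and> openin T P \<and> x + a n \<in> Q \<and> x \<in> P \<and> disjnt Q P" for n
  proof -
    have "x + a n \<noteq> x" using a(1) by simp
    then show ?thesis
      using Hausdorff unfolding Hausdorff_space_def topspace_eq_UNIV by blast
  qed
  then obtain Q P where QP: "\<And>n. openin T (Q n)" "\<And>n. openin T (P n)" "\<And>n. x + a n \<in> Q n"
      "\<And>n. x \<in> P n" "\<And>n. disjnt (Q n) (P n)"
    by metis
  \<comment> \<open>\<open>Q n\<close> is the set \<open>O\<^sub>n\<close> of the overview; its
    disjointness from the neighbourhood \<open>P n\<close> keeps \<open>x\<close> out of its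
    closure.\<close>
  define W where "W n = Q n \<inter> {z. z + - a n \<in> U n}" for n
  have "openin T (W n)" for n
    unfolding W_def by (intro openin_Int openin_translation_vimage QP U)
  then have "openin T (\<Union>n. W n)" by blast
  moreover have "x \<in> T closure_of (\<Union>n. W n)"
    unfolding in_closure_of
  proof (intro conjI allI impI)
    fix G assume G: "x \<in> G \<and> openin T G"
    have "limitin T (\<lambda>n. x + a n) (x + 0) sequentially"
      using a(2) by (intro limitin_add) (auto simp: topspace_eq_UNIV)
    then have "\<forall>\<^sub>F n in sequentially. x + a n \<in> G"
      using G by (simp add: limitin_def)
    then obtain n where n: "x + a n \<in> G"
      using eventually_happens by force
    \<comment> \<open>Translating \<open>G \<inter> Q n\<close> back by \<open>a n\<close> gives a
      neighbourhood of \<open>x\<close>, which therefore meets \<open>U n\<close>.\<close>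
    have "openin T {z. z + a n \<in> G \<inter> Q n}"
      using G QP(1) by (intro openin_translation_vimage openin_Int) simp_all
    moreover have "x \<in> {z. z + a n \<in> G \<inter> Q n}" using n QP(3) by simp
    ultimately have "\<exists>u. u \<in> U n \<and> u \<in> {z. z + a n \<in> G \<inter> Q n}"
      using U(2)[of n] by (simp only: in_closure_of)
    then obtain u where "u \<in> U n" "u + a n \<in> G \<inter> Q n"
      by blast
    then have "u + a n \<in> W n" "u + a n \<in> G"
      by (auto simp: W_def)
    then show "\<exists>y. y \<in> (\<Union>n. W n) \<and> y \<in> G" by blast
  qed (simp add: topspace_eq_UNIV)
  ultimately obtain s :: "nat \<Rightarrow> 'a" where s: "range s \<subseteq> (\<Union>n. W n)" "limitin T s x sequentially"
    using kFU unfolding kappa_frechet_urysohn_space_def by blast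
  then have "\<forall>k. \<exists>n. s k \<in> W n" by blast
  then obtain m where m: "\<And>k. s k \<in> W (m k)" by metis
  \<comment> \<open>The sequence ends up in \<open>P n\<close>, which misses \<open>W n\<close>, so
    each index occurs only finitely often.\<close>
  have ne: "\<forall>\<^sub>F k in sequentially. m k \<noteq> n" for n
  proof -
    have "\<forall>\<^sub>F k in sequentially. s k \<in> P n"
      using s(2) QP unfolding limitin_def by blast
    then show ?thesis
    proof eventually_elim
      case (elim k)
      then show ?case using m[of k] QP(5)[of n] by (auto simp: W_def disjnt_iff)
    qed
  qed
  have m_top: "filterlim m at_top sequentially"
    unfolding filterlim_at_top
  proof
    fix N
    have "\<forall>\<^sub>F k in sequentially. \<forall>n\<in>{..<N}. m k \<noteq> n"
      using ne by (intro eventually_ball_finite) auto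
    then show "\<forall>\<^sub>F k in sequentially. N \<le> m k"
      by eventually_elim (metis lessThan_iff not_le)
  qed
  have "limitin T (\<lambda>k. a (m k)) 0 sequentially"
    using a(2) m_top unfolding limitin_def by (auto intro: eventually_compose_filterlim)
  from limitin_diff[OF s(2) this] have "limitin T (\<lambda>k. s k - a (m k)) x sequentially"
    by simp
  moreover have "s k - a (m k) \<in> U (m k)" for k
    using m[of k] by (simp add: W_def)
  ultimately show thesis by (intro that[OF m_top])
qed

end

theorem corollary2p5:
  fixes scaleE :: "'k::real_normed_field \<Rightarrow> 'e::ab_group_add \<Rightarrow> 'e"
    and scaleF :: "'k \<Rightarrow> 'f::ab_group_add \<Rightarrow> 'f"
    and E :: "'e topology"
    and F :: "'f topology"
  assumes "topological_vector_space scaleE E"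
    and "kappa_frechet_urysohn_space E"
    and "topological_vector_space scaleF F"
    and "metrizable_space F"
  shows "kappa_frechet_urysohn_space (prod_topology E F)"
  unfolding kappa_frechet_urysohn_space_def
proof (intro conjI allI impI)
  show "tychonoff_space (prod_topology E F)"
    using assms(2,4)
    by (simp add: tychonoff_space_def kappa_frechet_urysohn_space_def
        completely_regular_space_prod_topology Hausdorff_space_prod_topology
        metrizable_imp_completely_regular_space metrizable_imp_Hausdorff_space)
next
  fix U p
  assume U: "openin (prod_topology E F) U \<and> p \<in> prod_topology E F closure_of U"
  interpret E: topological_vector_space scaleE E by fact
  obtain x y where p: "p = (x, y)" by fastforce
  obtain M d where M: "Metric_space M d" and F: "F = Metric_space.mtopology M d"
    using assms(4) unfolding metrizable_space_def by blast
  interpret M: Metric_space M d by fact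
  have y: "y \<in> M"
    using U unfolding p F in_closure_of by simp
  \<comment> \<open>\<open>Suc\<close> matters: at 0 the radius \<open>inverse 0\<close> would be 0
    and the ball empty.\<close>
  define B where "B n = M.mball y (inverse (real (Suc n)))" for n
  define V where "V n = fst ` (U \<inter> (UNIV \<times> B n))" for n
  have open_strip: "openin (prod_topology E F) (UNIV \<times> B n)" for n
    using openin_topspace[of E] unfolding E.topspace_eq_UNIV
    by (simp add: openin_prod_Times_iff B_def F)
  have V_open: "openin E (V n)" for n
    unfolding V_def using open_map_fst U open_strip by (metis open_map_def openin_Int)
  have V_closure: "x \<in> E closure_of V n" for n
    unfolding in_closure_of
  proof (intro conjI allI impI)
    fix G assume G: "x \<in> G \<and> openin E G"
    have "openin (prod_topology E F) (G \<times> B n)"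
      using G by (simp add: openin_prod_Times_iff B_def F)
    moreover have "(x, y) \<in> G \<times> B n" using G y by (simp add: B_def)
    ultimately have "\<exists>q. q \<in> U \<and> q \<in> G \<times> B n"
      using U by (simp only: p in_closure_of)
    then obtain q where "q \<in> U" "q \<in> G \<times> B n"
      by blast
    then have "fst q \<in> V n" "fst q \<in> G"
      by (auto simp: V_def)
    then show "\<exists>z. z \<in> V n \<and> z \<in> G" by blast
  qed (simp add: E.topspace_eq_UNIV)
  obtain m :: "nat \<Rightarrow> nat" and t where mt: "filterlim m at_top sequentially"
      "\<And>k. t k \<in> V (m k)" "limitin E t x sequentially"
  \<comment> \<open>If \<open>E\<close> is a single point, there are no nonzero shifts; but then
    each \<open>V n\<close>, being nonempty, contains \<open>x\<close>, and a constant sequence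
    works.\<close>
  proof (cases "\<exists>v::'e. v \<noteq> 0")
    case True
    then obtain v :: 'e where "v \<noteq> 0" ..
    from E.kappa_frechet_urysohn_diagonal_sequence[OF assms(2) this V_open V_closure]
    show thesis using that .
  next
    case False
    then have eq: "z = x" for z :: 'e by metis
    have "x \<in> V n" for n
    proof -
      obtain z where "z \<in> V n"
        using V_closure[of n] by (metis closure_of_empty empty_iff ex_in_conv)
      then show ?thesis using eq[of z] by simp
    qed
    then show thesis
      using that[of "\<lambda>k. k" "\<lambda>_. x"] by (simp add: filterlim_ident E.topspace_eq_UNIV)
  qed
  \<comment> \<open>Each \<open>t k\<close> is lifted to a point of \<open>U\<close> over it. Since
    \<open>m\<close> tends to infinity, the balls \<open>B (m k)\<close> force the second
    coordinates to \<open>y\<close>.\<close>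
  have "\<forall>k. \<exists>w. (t k, w) \<in> U \<and> w \<in> B (m k)"
    using mt(2) by (force simp: V_def)
  then obtain w where w: "\<And>k. (t k, w k) \<in> U" "\<And>k. w k \<in> B (m k)" by metis
  have "limitin F w y sequentially"
    unfolding F M.limitin_metric
  proof (intro conjI allI impI y)
    fix e :: real assume "e > 0"
    then have "\<forall>\<^sub>F n in sequentially. inverse (real (Suc n)) < e"
      using LIMSEQ_inverse_real_of_nat order_tendstoD(2) by blast
    then have "\<forall>\<^sub>F k in sequentially. inverse (real (Suc (m k))) < e"
      using mt(1) by (rule eventually_compose_filterlim)
    then show "\<forall>\<^sub>F k in sequentially. w k \<in> M \<and> d (w k) y < e"
    proof eventually_elim
      case (elim k)
      have "w k \<in> M" "d (w k) y < inverse (real (Suc (m k)))"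
        using w(2)[of k] by (auto simp: B_def M.commute)
      with elim show ?case by linarith
    qed
  qed
  then have "limitin (prod_topology E F) (\<lambda>k. (t k, w k)) p sequentially"
    using mt(3) by (simp add: limitin_pairwise o_def p)
  then show "\<exists>s. range s \<subseteq> U \<and> limitin (prod_topology E F) s p sequentially"
    using w(1) by (intro exI[of _ "\<lambda>k. (t k, w k)"]) auto
qed

end
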